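(* Let $N$ be a positive integer. Then the $N$th cyclotomic polynomial $\Phi_N$ divides $F_N$ if and only if the Goldbach conjecture fails for $N$, i.e. if and only if $N\notin\mathcal P+\mathcal P$.
   Context: $\mathcal P$ denotes the set of odd primes, $\mathcal P+\mathcal P=\{p+q: p,q\in\mathcal P\}$, and $\chi_{\mathcal P}:\mathbb N\to\{0,1\}$ is the indicator function of $\mathcal P$. The Goldbach conjecture is said to hold for a positive integer $N$ if $N\in\mathcal P+\mathcal P$, and to fail for $N$ otherwise. For each positive integer $N$, the polynomial $F_N\in\mathbb Z[z]$ is $F_N(z)=\sum_{k=0}^{N-1}\left(\sum_{n=1}^{N-1}\chi_{\mathcal P}(n)z^{kn}\right)^2$. Divisibility is in $\mathbb Z[z]$. *)

theory Defs
  imports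
    Complex_Main
    "HOL-Library.Set_Algebras"
    "HOL-Library.Indicator_Function"
    "HOL-Computational_Algebra.Computational_Algebra"
begin

definition odd_primes :: "nat set" where
  "odd_primes = {p. prime p \<and> odd p}"

definition goldbach_holds :: "nat \<Rightarrow> bool" where
  "goldbach_holds N \<longleftrightarrow> N \<in> odd_primes + odd_primes"

definition goldbach_poly :: "nat \<Rightarrow> int poly" where
  "goldbach_poly N =
     (\<Sum>k=0..N-1. (\<Sum>n=1..N-1. monom (indicator odd_primes n) (k * n))\<^sup>2)"

definition primitive_roots_of_unity :: "nat \<Rightarrow> complex set" where
  "primitive_roots_of_unity n = {z. n > 0 \<and> z ^ n = 1 \<and> (\<forall>k\<in>{1..<n}. z ^ k \<noteq> 1)}"

definition complex_cyclotomic :: "nat \<Rightarrow> complex poly" where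
  "complex_cyclotomic n = (\<Prod>z\<in>primitive_roots_of_unity n. [:-z, 1:])"

text \<open>
  The product has integer coefficients (see \<open>of_int_cyclotomic\<close> below), so the
  description in the following definition denotes, for every \<open>n\<close>, the unique
  integer polynomial with these coefficients.
\<close>

definition cyclotomic :: "nat \<Rightarrow> int poly" where
  "cyclotomic n = (THE p. map_poly of_int p = complex_cyclotomic n)"

lemma of_int_poly_1: "map_poly of_int 1 = (1 :: complex poly)"
  by (rule poly_eqI) (simp add: coeff_map_poly coeff_1)

lemma of_int_poly_add:
  "map_poly of_int (p + q) = (map_poly of_int p + map_poly of_int q :: complex poly)"
  by (rule poly_eqI) (simp add: coeff_map_poly)

lemma of_int_poly_diff:
  "map_poly of_int (p - q) = (map_poly of_int p - map_poly of_int q :: complex poly)"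
  by (rule poly_eqI) (simp add: coeff_map_poly)

lemma of_int_poly_mult:
  "map_poly of_int (p * q) = (map_poly of_int p * map_poly of_int q :: complex poly)"
  by (rule poly_eqI) (simp add: coeff_map_poly coeff_mult)

lemma of_int_poly_prod:
  "map_poly of_int (\<Prod>x\<in>A. f x) = (\<Prod>x\<in>A. map_poly of_int (f x) :: complex poly)"
  by (induction A rule: infinite_finite_induct) (simp_all add: of_int_poly_mult of_int_poly_1)

lemma of_int_poly_inj:
  "map_poly of_int p = (map_poly of_int q :: complex poly) \<Longrightarrow> p = q"
proof (rule poly_eqI)
  fix n assume "map_poly of_int p = (map_poly of_int q :: complex poly)"
  then have "coeff (map_poly of_int p :: complex poly) n = coeff (map_poly of_int q) n" by simp
  then show "coeff p n = coeff q n" by (simp add: coeff_map_poly)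
qed

lemma degree_of_int_poly: "degree (map_poly of_int p :: complex poly) = degree p"
  by (rule degree_map_poly) simp

lemma roots_of_unity_eq_UN_primitive:
  assumes "n > 0"
  shows "{z::complex. z ^ n = 1} = (\<Union>d\<in>{d. d dvd n}. primitive_roots_of_unity d)"
proof (intro equalityI subsetI)
  fix z :: complex assume "z \<in> {z. z ^ n = 1}"
  then have z: "z ^ n = 1" by simp
  define d where "d = (LEAST d. d > 0 \<and> z ^ d = 1)"
  have d: "d > 0 \<and> z ^ d = 1"
    unfolding d_def by (rule LeastI[of _ n]) (use z assms in auto)
  have least: "z ^ k \<noteq> 1" if "0 < k" "k < d" for k
    using not_less_Least[of k "\<lambda>d. d > 0 \<and> z ^ d = 1"] that by (auto simp: d_def)
  have "z ^ (n mod d) = z ^ (d * (n div d) + n mod d)"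
    using d by (simp only: power_add power_mult) simp
  also have "\<dots> = 1" using z by simp
  finally have "n mod d = 0" using least[of "n mod d"] d by (cases "n mod d = 0") auto
  then show "z \<in> (\<Union>d\<in>{d. d dvd n}. primitive_roots_of_unity d)"
    using d least by (auto simp: primitive_roots_of_unity_def intro!: exI[of _ d])
next
  fix z assume "z \<in> (\<Union>d\<in>{d. d dvd n}. primitive_roots_of_unity d)"
  then show "z \<in> {z. z ^ n = 1}"
    by (auto simp: primitive_roots_of_unity_def power_mult elim!: dvdE)
qed

lemma primitive_roots_of_unity_disjoint:
  assumes "d \<noteq> e"
  shows "primitive_roots_of_unity d \<inter> primitive_roots_of_unity e = {}"
  using assms by (cases "d < e") (force simp: primitive_roots_of_unity_def)+

lemma finite_primitive_roots_of_unity: "finite (primitive_roots_of_unity n)"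
proof (cases "n = 0")
  case False
  then have "finite {z::complex. z ^ n = 1}"
    by (intro finite_roots_unity) simp
  then show ?thesis
    by (rule rev_finite_subset) (auto simp: primitive_roots_of_unity_def)
qed (simp add: primitive_roots_of_unity_def)

lemma prod_complex_cyclotomic:
  assumes "n > 0"
  shows "(\<Prod>d | d dvd n. complex_cyclotomic d) = monom 1 n - 1"
proof -
  let ?p = "monom 1 n - 1 :: complex poly"
  have root: "poly ?p z = 0 \<longleftrightarrow> z ^ n = 1" for z by (simp add: poly_monom)
  have "rsquarefree ?p"
    unfolding rsquarefree_roots
  proof (intro allI notI)
    fix a assume "poly ?p a = 0 \<and> poly (pderiv ?p) a = 0"
    then have "a ^ n = 1" "of_nat n * a ^ (n - 1) = 0"
      by (auto simp: poly_monom pderiv_diff pderiv_monom)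
    with assms show False by (auto simp: power_0_left)
  qed
  then have "smult (lead_coeff ?p) (\<Prod>z | poly ?p z = 0. [:-z, 1:]) = ?p"
    by (rule complex_poly_decompose_rsquarefree)
  moreover have "lead_coeff ?p = 1"
  proof -
    have "degree (1 :: complex poly) < degree (monom (1::complex) n)"
      using assms by (simp add: degree_monom_eq)
    then have "degree ?p = n"
      using degree_add_eq_left[of "- 1 :: complex poly" "monom 1 n"] by (simp add: degree_monom_eq)
    then show ?thesis using assms by simp
  qed
  ultimately have "?p = (\<Prod>z | z ^ n = 1. [:-z, 1:])"
    by (simp only: root smult_1_left)
  also have "\<dots> = (\<Prod>d | d dvd n. complex_cyclotomic d)"
    unfolding roots_of_unity_eq_UN_primitive[OF assms] complex_cyclotomic_def
    by (rule prod.UNION_disjoint)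
      (use assms finite_primitive_roots_of_unity primitive_roots_of_unity_disjoint in auto)
  finally show ?thesis ..
qed

lemma lead_coeff_complex_cyclotomic: "lead_coeff (complex_cyclotomic n) = 1"
  unfolding complex_cyclotomic_def by (simp add: lead_coeff_prod)

lemma ex_of_int_cyclotomic: "\<exists>p. map_poly of_int p = complex_cyclotomic n"
proof (induction n rule: less_induct)
  case (less n)
  show ?case
  proof (cases "n = 0")
    case True
    then have "map_poly of_int 1 = complex_cyclotomic n"
      by (simp add: complex_cyclotomic_def primitive_roots_of_unity_def of_int_poly_1)
    then show ?thesis ..
  next
    case False
    from less obtain f where f: "\<And>d. d < n \<Longrightarrow> map_poly of_int (f d) = complex_cyclotomic d"
      by metis
    define D where "D = {d. d dvd n \<and> d \<noteq> n}"
    have D: "{d. d dvd n} = insert n D" "finite D" "n \<notin> D" "\<And>d. d \<in> D \<Longrightarrow> d < n"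
      using False by (auto simp: D_def dest: dvd_imp_le)
    define G where "G = (\<Prod>d\<in>D. f d)"
    have G: "map_poly of_int G = (\<Prod>d\<in>D. complex_cyclotomic d)"
      using D f by (simp add: G_def of_int_poly_prod)
    have "of_int (lead_coeff G) = lead_coeff (map_poly of_int G :: complex poly)"
      by (simp add: degree_of_int_poly coeff_map_poly)
    also have "\<dots> = 1" by (simp add: G lead_coeff_prod lead_coeff_complex_cyclotomic)
    finally have lc: "lead_coeff G = 1" by simp
    then have G0: "G \<noteq> 0" by auto
    obtain q r where qr: "pseudo_divmod (monom 1 n - 1) G = (q, r)" by fastforce
    from pseudo_divmod[OF G0 qr] lc
    have eq: "monom 1 n - 1 = G * q + r" and deg: "r = 0 \<or> degree r < degree G" by auto
    let ?G = "map_poly of_int G :: complex poly"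
    have "?G * complex_cyclotomic n = monom 1 n - 1"
      using prod_complex_cyclotomic[of n] False D by (simp add: G mult.commute)
    also have "\<dots> = map_poly of_int (monom 1 n - 1)"
      by (simp add: of_int_poly_diff map_poly_monom of_int_poly_1)
    also have "\<dots> = ?G * map_poly of_int q + map_poly of_int r"
      by (simp only: eq of_int_poly_add of_int_poly_mult)
    finally have *: "map_poly of_int r = ?G * (complex_cyclotomic n - map_poly of_int q)"
      by (simp add: algebra_simps)
    have "complex_cyclotomic n - map_poly of_int q = 0"
    proof (rule ccontr)
      assume nz: "complex_cyclotomic n - map_poly of_int q \<noteq> 0"
      have "?G \<noteq> 0" using G0 of_int_poly_inj[of G 0] by auto
      with nz * have "degree (map_poly of_int r :: complex poly) \<ge> degree ?G"
        and "map_poly of_int r \<noteq> (0 :: complex poly)"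
        by (auto simp: degree_mult_eq)
      with deg show False by (auto simp: degree_of_int_poly)
    qed
    then show ?thesis by (metis eq_iff_diff_eq_0)
  qed
qed

theorem of_int_cyclotomic: "map_poly of_int (cyclotomic n) = complex_cyclotomic n"
  unfolding cyclotomic_def using ex_of_int_cyclotomic of_int_poly_inj
  by (metis (mono_tags, lifting) theI_unique)

end

theory Submission
  imports Defs
begin

text \<open>
  At a primitive \<open>N\<close>th root of unity \<open>z\<close>, expanding the square and summing the geometric series
  over \<open>k\<close> leaves \<open>N\<close> times the number of pairs of odd primes \<open>m, n < N\<close> with \<open>N\<close> dividing
  \<open>m + n\<close>. As \<open>0 < m + n < 2 N\<close>, these are the pairs with \<open>m + n = N\<close>. So the polynomial vanishes
  at one, equivalently at every, primitive root precisely when the Goldbach conjecture fails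
  for \<open>N\<close>.
\<close>

lemma of_int_poly_sum:
  "map_poly of_int (\<Sum>x\<in>A. f x) = (\<Sum>x\<in>A. map_poly of_int (f x) :: complex poly)"
  by (induction A rule: infinite_finite_induct) (simp_all add: of_int_poly_add)

text \<open>Dividing by a monic polynomial keeps quotient and remainder integral. Over the complex
  numbers the remainder is then a multiple of \<open>p\<close> of smaller degree, hence 0.\<close>

lemma monic_dvd_of_complex_dvd:
  fixes p q :: "int poly"
  assumes "lead_coeff p = 1"
    and "map_poly of_int p dvd (map_poly of_int q :: complex poly)"
  shows "p dvd q"
proof -
  let ?c = "map_poly of_int :: int poly \<Rightarrow> complex poly"
  have "p \<noteq> 0" using assms(1) by auto
  obtain s r where sr: "pseudo_divmod q p = (s, r)" by fastforce
  \<comment> \<open>Pseudo-division scales \<open>q\<close> by a power of the leading coefficient of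
    \<open>p\<close>; here that power is 1.\<close>
  from pseudo_divmod[OF \<open>p \<noteq> 0\<close> sr] assms(1)
  have eq: "q = p * s + r" and deg: "r = 0 \<or> degree r < degree p" by auto
  have "?c q = ?c p * ?c s + ?c r" by (simp only: eq of_int_poly_add of_int_poly_mult)
  with assms(2) have dvd: "?c p dvd ?c r" by (metis dvd_add_right_iff dvd_triv_left)
  have "r = 0"
  proof (rule ccontr)
    assume "r \<noteq> 0"
    then have "?c r \<noteq> 0" using of_int_poly_inj[of r 0] by auto
    with dvd have "degree p \<le> degree r" by (metis dvd_imp_degree_le degree_of_int_poly)
    with deg \<open>r \<noteq> 0\<close> show False by simp
  qed
  with eq show ?thesis by simp
qed

lemma prod_linear_dvd:
  fixes p :: "'a::idom poly"
  assumes "finite A" and "\<And>z. z \<in> A \<Longrightarrow> poly p z = 0"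
  shows "(\<Prod>z\<in>A. [:-z, 1:]) dvd p"
  using assms
proof (induction A)
  case (insert x A)
  then obtain q where q: "p = (\<Prod>z\<in>A. [:-z, 1:]) * q" by (meson dvdE insertCI)
  \<comment> \<open>As \<open>x\<close> is not in \<open>A\<close>, the root \<open>x\<close> of
    \<open>p\<close> must come from the cofactor \<open>q\<close>.\<close>
  have "poly (\<Prod>z\<in>A. [:-z, 1:]) x \<noteq> 0"
    using insert.hyps by (auto simp: poly_prod)
  moreover have "poly p x = 0" using insert.prems by simp
  ultimately have "[:-x, 1:] dvd q" by (simp add: q poly_eq_0_iff_dvd)
  then have "[:-x, 1:] * (\<Prod>z\<in>A. [:-z, 1:]) dvd p"
    unfolding q by (subst (2) mult.commute) (rule mult_dvd_mono[OF _ dvd_refl])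
  then show ?case by (simp only: prod.insert[OF insert.hyps])
qed simp

text \<open>Turns divisibility over the integers into evaluation: the complex cyclotomic polynomial
  is a product of distinct linear factors, and monicity brings divisibility back to integer
  polynomials.\<close>

lemma cyclotomic_dvd_iff:
  "cyclotomic n dvd p \<longleftrightarrow> (\<forall>z\<in>primitive_roots_of_unity n. poly (map_poly of_int p) z = 0)"
proof
  assume "cyclotomic n dvd p"
  then obtain q where "p = cyclotomic n * q" ..
  then show "\<forall>z\<in>primitive_roots_of_unity n. poly (map_poly of_int p) z = 0"
    by (auto simp: of_int_poly_mult of_int_cyclotomic complex_cyclotomic_def poly_prod
        finite_primitive_roots_of_unity)
next
  assume "\<forall>z\<in>primitive_roots_of_unity n. poly (map_poly of_int p) z = 0"
  then have "complex_cyclotomic n dvd map_poly of_int p"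
    unfolding complex_cyclotomic_def
    by (intro prod_linear_dvd finite_primitive_roots_of_unity) auto
  moreover have "of_int (lead_coeff (cyclotomic n)) = (1 :: complex)"
    using lead_coeff_complex_cyclotomic[of n]
    by (simp flip: of_int_cyclotomic add: degree_of_int_poly coeff_map_poly)
  then have "lead_coeff (cyclotomic n) = 1" by simp
  ultimately show "cyclotomic n dvd p"
    by (intro monic_dvd_of_complex_dvd) (simp_all add: of_int_cyclotomic)
qed

lemma primitive_root_power_eq_1_iff:
  assumes "z \<in> primitive_roots_of_unity n"
  shows "z ^ s = 1 \<longleftrightarrow> n dvd s"
proof -
  from assms have z: "n > 0" "z ^ n = 1" and least: "\<And>k. 0 < k \<Longrightarrow> k < n \<Longrightarrow> z ^ k \<noteq> 1"
    by (auto simp: primitive_roots_of_unity_def)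
  have "z ^ s = z ^ (n * (s div n) + s mod n)" by simp
  also have "\<dots> = z ^ (s mod n)" using z by (simp only: power_add power_mult) simp
  finally show ?thesis using least[of "s mod n"] z by (auto simp: dvd_eq_mod_eq_0)
qed

text \<open>Keeps vanishing at all primitive roots from being vacuous, so that divisibility forces
  the number of Goldbach pairs to be 0.\<close>

lemma primitive_roots_of_unity_nonempty:
  assumes "n > 0"
  shows "primitive_roots_of_unity n \<noteq> {}"
proof -
  let ?z = "cis (2 * pi / real n)"
  have "?z ^ n = 1" using assms by (simp add: DeMoivre)
  moreover have "?z ^ k \<noteq> 1" if "k \<in> {1..<n}" for k
  proof
    assume "?z ^ k = 1"
    then have "cos (real k * (2 * pi / real n)) = 1" by (simp add: DeMoivre complex_eq_iff)
    then obtain j :: int where "real k * (2 * pi / real n) = of_int j * 2 * pi"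
      by (auto simp: cos_one_2pi_int)
    then have "real k = of_int j * real n" using assms by (simp add: field_simps)
    then have "int k = j * int n" by (metis of_int_eq_iff of_int_mult of_int_of_nat_eq)
    then have "n dvd k" by (metis dvd_triv_right int_dvd_int_iff)
    with that show False by (auto dest: dvd_imp_le)
  qed
  ultimately show ?thesis using assms by (auto simp: primitive_roots_of_unity_def)
qed

lemma sum_primitive_root_powers:
  assumes "z \<in> primitive_roots_of_unity n"
  shows "(\<Sum>k<n. z ^ (k * s)) = (if n dvd s then of_nat n else 0)"
proof -
  have "(\<Sum>k<n. z ^ (k * s)) = (\<Sum>k<n. (z ^ s) ^ k)"
    by (simp add: mult.commute flip: power_mult)
  also have "\<dots> = (if n dvd s then of_nat n else 0)"
    \<comment> \<open>The instance \<open>s * n\<close> shows that the numerator of the geometric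
      sum vanishes when \<open>z ^ s\<close> is not 1.\<close>
    using primitive_root_power_eq_1_iff[OF assms, of s] primitive_root_power_eq_1_iff[OF assms, of "s * n"]
    by (auto simp: geometric_sum power_mult)
  finally show ?thesis .
qed

lemma poly_goldbach_poly:
  fixes z :: complex
  shows "poly (map_poly of_int (goldbach_poly N)) z =
     (\<Sum>k=0..N-1. (\<Sum>n=1..N-1. indicator odd_primes n * z ^ (k * n))\<^sup>2)"
proof -
  have ind: "of_int (indicator A x) = (indicator A x :: complex)" for A and x :: nat
    by (simp add: indicator_def)
  show ?thesis
    by (simp add: goldbach_poly_def of_int_poly_sum of_int_poly_mult power2_eq_square poly_sum
        map_poly_monom poly_monom ind)
qed

definition goldbach_pairs :: "nat \<Rightarrow> (nat \<times> nat) set" where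
  "goldbach_pairs N = {(m, n). m \<in> odd_primes \<and> n \<in> odd_primes \<and> m + n = N}"

text \<open>Since \<open>card\<close> is also 0 on infinite sets, finiteness is what lets a zero
  count mean that no pair exists.\<close>

lemma finite_goldbach_pairs: "finite (goldbach_pairs N)"
  by (rule finite_subset[of _ "{..N} \<times> {..N}"]) (auto simp: goldbach_pairs_def)

lemma goldbach_holds_iff: "goldbach_holds N \<longleftrightarrow> goldbach_pairs N \<noteq> {}"
  by (auto simp: goldbach_holds_def goldbach_pairs_def set_plus_def)

lemma goldbach_poly_primitive_root:
  assumes "z \<in> primitive_roots_of_unity N"
  shows "poly (map_poly of_int (goldbach_poly N)) z = of_nat (N * card (goldbach_pairs N))"
proof -
  have N: "N > 0" using assms by (simp add: primitive_roots_of_unity_def)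
  let ?i = "indicator odd_primes :: nat \<Rightarrow> complex" and ?I = "{1..N-1}"
  have "poly (map_poly of_int (goldbach_poly N)) z =
      (\<Sum>k<N. \<Sum>(m, n)\<in>?I \<times> ?I. ?i m * ?i n * z ^ (k * (m + n)))"
    \<comment> \<open>With truncated subtraction, \<open>{0..N-1}\<close> agrees with
      \<open>{..<N}\<close> only because \<open>N\<close> is positive.\<close>
    unfolding poly_goldbach_poly power2_eq_square sum_product sum.cartesian_product using N
    by (intro sum.cong) (auto simp: distrib_left power_add simp del: mult_eq_0_iff)
  also have "\<dots> = (\<Sum>(m, n)\<in>?I \<times> ?I. ?i m * ?i n * (\<Sum>k<N. z ^ (k * (m + n))))"
    by (subst sum.swap) (simp add: case_prod_unfold sum_distrib_left)
  also have "\<dots> = (\<Sum>x\<in>?I \<times> ?I. if x \<in> goldbach_pairs N then of_nat N else 0)"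
  proof (rule sum.cong)
    fix x assume x: "x \<in> ?I \<times> ?I"
    have "N dvd fst x + snd x \<longleftrightarrow> fst x + snd x = N"
    proof
      assume "N dvd fst x + snd x"
      then obtain c where c: "fst x + snd x = N * c" ..
      from x have "0 < fst x + snd x" "fst x + snd x < N * 2" by (auto simp: mem_Times_iff)
      then have "0 < N * c" "N * c < N * 2" by (simp_all only: c)
      then have "c = 1" by simp
      with c show "fst x + snd x = N" by simp
    qed simp
    then show "(case x of (m, n) \<Rightarrow> ?i m * ?i n * (\<Sum>k<N. z ^ (k * (m + n)))) =
        (if x \<in> goldbach_pairs N then of_nat N else 0)"
      by (auto simp: sum_primitive_root_powers[OF assms] goldbach_pairs_def indicator_def
          case_prod_unfold)
  qed simp
  also have "\<dots> = (\<Sum>x\<in>(?I \<times> ?I) \<inter> goldbach_pairs N. of_nat N)"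
    by (rule sum.inter_restrict[symmetric]) simp
  \<comment> \<open>Both summands are positive, so each is at most \<open>N-1\<close> and the range
    of summation loses no pair.\<close>
  also have "(?I \<times> ?I) \<inter> goldbach_pairs N = goldbach_pairs N"
  proof -
    have "0 < p" if "p \<in> odd_primes" for p
      using that by (simp add: odd_primes_def prime_gt_0_nat)
    then show ?thesis by (fastforce simp: goldbach_pairs_def)
  qed
  finally show ?thesis by simp
qed

theorem theorem1p2:
  fixes N :: nat
  assumes "N > 0"
  shows "cyclotomic N dvd goldbach_poly N \<longleftrightarrow> \<not> goldbach_holds N"
  using assms primitive_roots_of_unity_nonempty[OF assms]
  by (auto simp: cyclotomic_dvd_iff goldbach_poly_primitive_root goldbach_holds_iff
      finite_goldbach_pairs)

end
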